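(* Let an explicit $s$-stage Runge--Kutta method with operator $R_s=\sum_{k=0}^s\alpha_k(\tau L)^k$ be given, and let $k^*$ be its leading index and $\beta_{k^*}$ its leading coefficient. The method is not strongly stable if $\beta_{k^*}>0$. More specifically, if $\beta_{k^*}>0$, then there exists a constant $\lambda>0$ such that $\|R_s\|_H>1$ whenever $0<\tau\|L\|_H\le\lambda$ and $L^\top H+HL=0$.
   Context: An explicit $s$-stage Runge--Kutta (RK) method ($s\ge 1$) applied to the linear autonomous system $\frac{d}{dt}u=Lu$, $u\in\mathbb{R}^N$, $L\in\mathbb{R}^{N\times N}$, with time step $\tau>0$ takes the form $u^{n+1}=R_s u^n$, where $R_s=\sum_{k=0}^s\alpha_k(\tau L)^k$ with real coefficients $\alpha_k$ depending only on the method, $\alpha_0=1$, $\alpha_s\ne 0$. For a real symmetric positive definite $N\times N$ matrix $H$, let $\langle v,w\rangle_H=\langle v,Hw\rangle$ ($\langle\cdot,\cdot\rangle$ the Euclidean inner product), $\|v\|_H=\sqrt{\langle v,v\rangle_H}$, and let $\|A\|_H$ be the induced operator norm of a matrix $A$. $L$ is semi-negative (with respect to $H$) if $L^\top H+HL\le 0$, i.e. is negative semi-definite. For semi-negative $L$ put $[v,w]_H=-\langle v,(L^\top H+HL)w\rangle$ (a semi inner product). The method is strongly stable if there exists a constant $\lambda>0$ (depending only on the method) such that for all $N$, all symmetric positive definite $H\in\mathbb{R}^{N\times N}$, all $L\in\mathbb{R}^{N\times N}$ semi-negative with respect to $H$ and all $\tau>0$ with $\tau\|L\|_H\le\lambda$,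 one has $\|R_s\|_H\le 1$. Energy equality: there are unique real coefficients $\{\beta_k\}_{k=0}^s$ and $\{\gamma_{i,j}\}_{i,j=0}^{s-1}$ with $\gamma_{i,j}=\gamma_{j,i}$, depending only on $\alpha_0,\dots,\alpha_s$, such that for all $N$, $H$ symmetric positive definite, $L$ semi-negative with respect to $H$, $u\in\mathbb{R}^N$ and $\tau$, $$\|R_su\|_H^2=\sum_{k=0}^s\beta_k\tau^{2k}\|L^ku\|_H^2+\sum_{i,j=0}^{s-1}\gamma_{i,j}\tau^{i+j+1}[L^iu,L^ju]_H .$$ The leading index $k^*$ is the positive integer with $\beta_{k^*}\ne0$ and $\beta_k=0$ for all $1\le k<k^*$ (it exists and $k^*\le s$, since $\beta_s=\alpha_s^2\neq0$). $\beta_{k^*}$ is called the leading coefficient. *)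

theory Defs
  imports Complex_Main "Jordan_Normal_Form.Matrix"
begin

text \<open>Vectors and matrices carry their dimension as a natural number, because strong stability
  and the energy equality quantify over all dimensions.\<close>

definition sym_pos_def :: "nat \<Rightarrow> real mat \<Rightarrow> bool" where
  "sym_pos_def N H \<longleftrightarrow> H \<in> carrier_mat N N \<and> transpose_mat H = H \<and>
     (\<forall>v \<in> carrier_vec N. v \<noteq> 0\<^sub>v N \<longrightarrow> 0 < v \<bullet> (H *\<^sub>v v))"

definition inner_H :: "real mat \<Rightarrow> real vec \<Rightarrow> real vec \<Rightarrow> real" where
  "inner_H H v w = v \<bullet> (H *\<^sub>v w)"

definition norm_H :: "real mat \<Rightarrow> real vec \<Rightarrow> real" where
  "norm_H H v = sqrt (inner_H H v v)"

text \<open>The operator norm as a supremum over the closed unit ball; the set is nonempty in every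
  dimension, so that it takes the value 0 in dimension 0.\<close>

definition opnorm_H :: "real mat \<Rightarrow> real mat \<Rightarrow> real" where
  "opnorm_H H A = Sup {norm_H H (A *\<^sub>v v) | v. v \<in> carrier_vec (dim_row H) \<and> norm_H H v \<le> 1}"

definition semi_negative :: "nat \<Rightarrow> real mat \<Rightarrow> real mat \<Rightarrow> bool" where
  "semi_negative N H L \<longleftrightarrow> L \<in> carrier_mat N N \<and>
     (\<forall>v \<in> carrier_vec N. v \<bullet> ((transpose_mat L * H + H * L) *\<^sub>v v) \<le> 0)"

definition semi_inner_H :: "real mat \<Rightarrow> real mat \<Rightarrow> real vec \<Rightarrow> real vec \<Rightarrow> real" where
  "semi_inner_H H L v w = - (v \<bullet> ((transpose_mat L * H + H * L) *\<^sub>v w))"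

definition rk_coeffs :: "nat \<Rightarrow> (nat \<Rightarrow> real) \<Rightarrow> bool" where
  "rk_coeffs s \<alpha> \<longleftrightarrow> 1 \<le> s \<and> \<alpha> 0 = 1 \<and> \<alpha> s \<noteq> 0"

text \<open>The matrix polynomial \<open>\<Sum>k\<le>s. \<alpha> k (\<tau> L)^k\<close>, summed entrywise because the type of matrices
  has no zero that is independent of the dimension.\<close>

definition rk_operator :: "nat \<Rightarrow> (nat \<Rightarrow> real) \<Rightarrow> real \<Rightarrow> real mat \<Rightarrow> real mat" where
  "rk_operator s \<alpha> \<tau> L =
     mat (dim_row L) (dim_row L) (\<lambda>(i, j). \<Sum>k\<le>s. \<alpha> k * ((\<tau> \<cdot>\<^sub>m L) ^\<^sub>m k) $$ (i, j))"

definition strongly_stable :: "nat \<Rightarrow> (nat \<Rightarrow> real) \<Rightarrow> bool" where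
  "strongly_stable s \<alpha> \<longleftrightarrow>
     (\<exists>c>0. \<forall>N H L \<tau>. sym_pos_def N H \<longrightarrow> semi_negative N H L \<longrightarrow> 0 < \<tau> \<longrightarrow>
        \<tau> * opnorm_H H L \<le> c \<longrightarrow> opnorm_H H (rk_operator s \<alpha> \<tau> L) \<le> 1)"

text \<open>\<open>\<beta>\<close> and \<open>\<gamma>\<close> are the coefficients of the energy equality of the method; only the values
  \<open>\<beta> k\<close> with \<open>k \<le> s\<close> and \<open>\<gamma> i j\<close> with \<open>i, j < s\<close> matter. That such coefficients exist is
  lemma \<open>energy_coeffs_exist\<close> below.\<close>

definition energy_coeffs ::
  "nat \<Rightarrow> (nat \<Rightarrow> real) \<Rightarrow> (nat \<Rightarrow> real) \<Rightarrow> (nat \<Rightarrow> nat \<Rightarrow> real) \<Rightarrow> bool" where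
  "energy_coeffs s \<alpha> \<beta> \<gamma> \<longleftrightarrow>
     (\<forall>i<s. \<forall>j<s. \<gamma> i j = \<gamma> j i) \<and>
     (\<forall>N H L u \<tau>. sym_pos_def N H \<longrightarrow> semi_negative N H L \<longrightarrow> u \<in> carrier_vec N \<longrightarrow> 0 < \<tau> \<longrightarrow>
        (norm_H H (rk_operator s \<alpha> \<tau> L *\<^sub>v u))\<^sup>2 =
          (\<Sum>k\<le>s. \<beta> k * \<tau> ^ (2 * k) * (norm_H H ((L ^\<^sub>m k) *\<^sub>v u))\<^sup>2) +
          (\<Sum>i<s. \<Sum>j<s. \<gamma> i j * \<tau> ^ (i + j + 1) *
             semi_inner_H H L ((L ^\<^sub>m i) *\<^sub>v u) ((L ^\<^sub>m j) *\<^sub>v u)))"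

definition leading_index :: "nat \<Rightarrow> (nat \<Rightarrow> real) \<Rightarrow> nat \<Rightarrow> bool" where
  "leading_index s \<beta> k \<longleftrightarrow> 1 \<le> k \<and> k \<le> s \<and> \<beta> k \<noteq> 0 \<and> (\<forall>j. 1 \<le> j \<and> j < k \<longrightarrow> \<beta> j = 0)"


subsection \<open>Existence of the energy equality\<close>

definition energy_form ::
  "nat \<Rightarrow> (nat \<Rightarrow> real) \<Rightarrow> (nat \<Rightarrow> nat \<Rightarrow> real) \<Rightarrow> (nat \<Rightarrow> nat \<Rightarrow> real) \<Rightarrow> real" where
  "energy_form s \<beta> \<gamma> a =
     (\<Sum>k\<le>s. \<beta> k * a k k) + (\<Sum>i<s. \<Sum>j<s. \<gamma> i j * - (a (Suc i) j + a i (Suc j)))"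

definition reducible_form :: "nat \<Rightarrow> ((nat \<Rightarrow> nat \<Rightarrow> real) \<Rightarrow> real) \<Rightarrow> bool" where
  "reducible_form s f \<longleftrightarrow> (\<exists>\<beta> \<gamma>. (\<forall>i j. \<gamma> i j = \<gamma> j i) \<and>
     (\<forall>a. (\<forall>i j. a i j = a j i) \<longrightarrow> f a = energy_form s \<beta> \<gamma> a))"

lemma reducible_formI:
  assumes "\<And>i j. \<gamma> i j = \<gamma> j i"
    and "\<And>a. (\<forall>i j. a i j = a j i) \<Longrightarrow> f a = energy_form s \<beta> \<gamma> a"
  shows "reducible_form s f"
  unfolding reducible_form_def using assms by blast

lemma reducible_form_add:
  assumes "reducible_form s f" "reducible_form s g"
  shows "reducible_form s (\<lambda>a. f a + g a)"
proof -
  obtain b1 g1 where 1: "\<And>i j. g1 i j = g1 j i"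
    "\<And>a. (\<forall>i j. a i j = a j i) \<Longrightarrow> f a = energy_form s b1 g1 a"
    using assms(1) unfolding reducible_form_def by blast
  obtain b2 g2 where 2: "\<And>i j. g2 i j = g2 j i"
    "\<And>a. (\<forall>i j. a i j = a j i) \<Longrightarrow> g a = energy_form s b2 g2 a"
    using assms(2) unfolding reducible_form_def by blast
  show ?thesis
  proof (rule reducible_formI[where \<gamma> = "\<lambda>i j. g1 i j + g2 i j" and \<beta> = "\<lambda>k. b1 k + b2 k"])
    show "g1 i j + g2 i j = g1 j i + g2 j i" for i j
      unfolding 1(1)[of i j] 2(1)[of i j] ..
    show "f a + g a = energy_form s (\<lambda>k. b1 k + b2 k) (\<lambda>i j. g1 i j + g2 i j) a"
      if "\<forall>i j. a i j = a j i" for a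
      unfolding 1(2)[OF that] 2(2)[OF that] energy_form_def distrib_right sum.distrib by linarith
  qed
qed

lemma reducible_form_scale:
  assumes "reducible_form s f"
  shows "reducible_form s (\<lambda>a. c * f a)"
proof -
  obtain b1 g1 where 1: "\<And>i j. g1 i j = g1 j i"
    "\<And>a. (\<forall>i j. a i j = a j i) \<Longrightarrow> f a = energy_form s b1 g1 a"
    using assms(1) unfolding reducible_form_def by blast
  show ?thesis
  proof (rule reducible_formI[where \<gamma> = "\<lambda>i j. c * g1 i j" and \<beta> = "\<lambda>k. c * b1 k"])
    show "c * g1 i j = c * g1 j i" for i j
      unfolding 1(1)[of i j] ..
    show "c * f a = energy_form s (\<lambda>k. c * b1 k) (\<lambda>i j. c * g1 i j) a"
      if "\<forall>i j. a i j = a j i" for a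
      unfolding 1(2)[OF that] energy_form_def distrib_left[of c] sum_distrib_left mult.assoc ..
  qed
qed

lemma reducible_form_sum:
  assumes "\<And>k. k \<in> S \<Longrightarrow> reducible_form s (f k)" "finite S"
  shows "reducible_form s (\<lambda>a. \<Sum>k\<in>S. f k a)"
  using assms(2,1)
proof (induction S rule: finite_induct)
  case empty
  show ?case
    by (intro reducible_formI[where \<gamma> = "\<lambda>i j. 0" and \<beta> = "\<lambda>k. 0"])
      (simp_all add: energy_form_def)
next
  case (insert x F)
  then show ?case by (simp add: reducible_form_add)
qed

lemma double_sum_delta:
  fixes h :: "nat \<Rightarrow> nat \<Rightarrow> real"
  assumes "p < s" "q < s"
  shows "(\<Sum>i<s. \<Sum>j<s. (if i = p \<and> j = q then 1 else 0) * h i j) = h p q"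
proof -
  have "(\<Sum>j<s. (if i = p \<and> j = q then 1 else 0) * h i j) = (if i = p then h i q else 0)" for i
  proof -
    have "(\<Sum>j<s. (if i = p \<and> j = q then 1 else 0) * h i j)
        = (\<Sum>j<s. if j = q then (if i = p then h i j else 0) else 0)"
      by (rule sum.cong) auto
    also have "\<dots> = (if i = p then h i q else 0)" using assms by simp
    finally show ?thesis .
  qed
  then show ?thesis using assms by simp
qed

lemma reducible_form_off:
  assumes "p < s" "q < s"
  shows "reducible_form s (\<lambda>a. - (a (Suc p) q + a p (Suc q)))"
proof -
  define d where "d = (\<lambda>(p::nat) (q::nat) i j. if i = p \<and> j = q then 1 else (0::real))"
  have "- (a (Suc p) q + a p (Suc q)) = energy_form s (\<lambda>k. 0) (\<lambda>i j. (d p q i j + d q p i j) / 2) a"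
    if sym: "\<forall>i j. a i j = a j i" for a :: "nat \<Rightarrow> nat \<Rightarrow> real"
  proof -
    define h where "h i j = - (a (Suc i) j + a i (Suc j))" for i j
    have eq: "energy_form s (\<lambda>k. 0) (\<lambda>i j. (d p q i j + d q p i j) / 2) a
        = (\<Sum>i<s. \<Sum>j<s. d p q i j * h i j) / 2 + (\<Sum>i<s. \<Sum>j<s. d q p i j * h i j) / 2"
      unfolding energy_form_def h_def[symmetric]
      by (simp only: add_divide_distrib distrib_right sum.distrib sum_divide_distrib
          times_divide_eq_left mult_zero_left sum.neutral_const add_0)
    have "a (Suc p) q = a q (Suc p)" "a p (Suc q) = a (Suc q) p"
      using sym by blast+
    then have "h q p = h p q"
      unfolding h_def by linarith
    moreover have "(\<Sum>i<s. \<Sum>j<s. d p q i j * h i j) = h p q"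
      unfolding d_def by (rule double_sum_delta[OF assms])
    moreover have "(\<Sum>i<s. \<Sum>j<s. d q p i j * h i j) = h q p"
      unfolding d_def by (rule double_sum_delta[OF assms(2,1)])
    ultimately have "energy_form s (\<lambda>k. 0) (\<lambda>i j. (d p q i j + d q p i j) / 2) a = h p q"
      unfolding eq by simp
    then show ?thesis unfolding h_def by simp
  qed
  note eq = this
  have d_swap: "d x y i j = d y x j i" for x y i j
    unfolding d_def by (simp add: conj_commute)
  show ?thesis
  proof (rule reducible_formI[where \<gamma> = "\<lambda>i j. (d p q i j + d q p i j) / 2" and \<beta> = "\<lambda>k. 0"])
    show "(d p q i j + d q p i j) / 2 = (d p q j i + d q p j i) / 2" for i j
      unfolding d_swap[of p q i j] d_swap[of q p i j] by (simp only: add.commute)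
  qed (rule eq)
qed

lemma reducible_form_cong:
  assumes "reducible_form s g" "\<And>a. (\<And>i j. a i j = a j i) \<Longrightarrow> f a = g a"
  shows "reducible_form s f"
proof -
  obtain \<beta> \<gamma> where 1: "\<And>i j. \<gamma> i j = \<gamma> j i"
    "\<And>a. (\<forall>i j. a i j = a j i) \<Longrightarrow> g a = energy_form s \<beta> \<gamma> a"
    using assms(1) unfolding reducible_form_def by blast
  show ?thesis
  proof (rule reducible_formI[where \<gamma> = \<gamma> and \<beta> = \<beta>])
    show "\<gamma> i j = \<gamma> j i" for i j by (rule 1(1))
    show "f a = energy_form s \<beta> \<gamma> a" if "\<forall>i j. a i j = a j i" for a
      using assms(2)[of a] 1(2)[OF that] that by simp
  qed
qed

lemma reducible_form_entry_aux: "i + d \<le> s \<Longrightarrow> reducible_form s (\<lambda>a. a i (i + d))"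
proof (induction d arbitrary: i rule: less_induct)
  case (less d)
  consider "d = 0" | "d = 1" | "2 \<le> d" by linarith
  then show ?case
  proof cases
    case 1
    have "(\<Sum>k\<le>s. (if k = i then 1 else 0) * a k k) = a i i" for a :: "nat \<Rightarrow> nat \<Rightarrow> real"
    proof -
      have "(\<Sum>k\<le>s. (if k = i then 1 else 0) * a k k) = (\<Sum>k\<le>s. if k = i then a k k else 0)"
        by (rule sum.cong) auto
      then show ?thesis using less.prems by simp
    qed
    then show ?thesis unfolding 1
      by (intro reducible_formI[where \<gamma> = "\<lambda>i j. 0" and \<beta> = "\<lambda>k. if k = i then 1 else 0"])
        (simp_all add: energy_form_def)
  next
    case 2
    have "reducible_form s (\<lambda>a. (-1/2) * - (a (Suc i) i + a i (Suc i)))"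
      using less.prems 2 by (intro reducible_form_scale reducible_form_off) auto
    then show ?thesis
    proof (rule reducible_form_cong)
      fix a :: "nat \<Rightarrow> nat \<Rightarrow> real"
      assume "\<And>i j. a i j = a j i"
      from this[of "Suc i" i] show "a i (i + d) = (-1/2) * - (a (Suc i) i + a i (Suc i))"
        using 2 by simp
    qed
  next
    case 3
    define e where "e = d - 2"
    have d: "d = Suc (Suc e)" using 3 by (simp add: e_def)
    have "reducible_form s (\<lambda>a. (-1) * - (a (Suc i) (i + Suc e) + a i (Suc (i + Suc e))) +
        (-1) * a (Suc i) (Suc i + e))"
    proof (rule reducible_form_add[OF reducible_form_scale reducible_form_scale])
      show "reducible_form s (\<lambda>a. - (a (Suc i) (i + Suc e) + a i (Suc (i + Suc e))))"
        using less.prems d by (intro reducible_form_off) auto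
      show "reducible_form s (\<lambda>a. a (Suc i) (Suc i + e))"
        using less.prems d by (intro less.IH) auto
    qed
    then show ?thesis
      by (rule reducible_form_cong) (simp add: d)
  qed
qed

lemma reducible_form_entry:
  assumes "i \<le> s" "j \<le> s"
  shows "reducible_form s (\<lambda>a. a i j)"
proof (cases "i \<le> j")
  case True
  then show ?thesis using reducible_form_entry_aux[of i "j - i" s] assms by simp
next
  case False
  then have "reducible_form s (\<lambda>a. a j i)"
    using reducible_form_entry_aux[of j "i - j" s] assms by simp
  then show ?thesis by (rule reducible_form_cong) simp
qed

lemma quadratic_reducible:
  "reducible_form s (\<lambda>a. \<Sum>i\<le>s. \<Sum>j\<le>s. \<alpha> i * \<alpha> j * a i j)"
proof (rule reducible_form_sum, rule reducible_form_sum)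
  fix i j
  assume "i \<in> {..s}" "j \<in> {..s}"
  then have "reducible_form s (\<lambda>a. a i j)" by (simp add: reducible_form_entry)
  then show "reducible_form s (\<lambda>a. \<alpha> i * \<alpha> j * a i j)" by (rule reducible_form_scale)
qed simp_all

lemma inner_H_commute:
  assumes "sym_pos_def N H" "x \<in> carrier_vec N" "y \<in> carrier_vec N"
  shows "inner_H H x y = inner_H H y x"
proof -
  have H: "H \<in> carrier_mat N N" "transpose_mat H = H"
    using assms(1) unfolding sym_pos_def_def by auto
  have "x \<bullet> (H *\<^sub>v y) = (H *\<^sub>v x) \<bullet> y"
    using transpose_vec_mult_scalar[OF H(1) assms(3,2)] H(2) by simp
  also have "\<dots> = y \<bullet> (H *\<^sub>v x)"
    using H(1) assms(2,3) by (intro comm_scalar_prod[of _ N]) auto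
  finally show ?thesis unfolding inner_H_def .
qed

lemma inner_H_nonneg:
  assumes "sym_pos_def N H" "x \<in> carrier_vec N"
  shows "0 \<le> inner_H H x x"
proof (cases "x = 0\<^sub>v N")
  case True
  then show ?thesis using assms unfolding sym_pos_def_def inner_H_def by auto
next
  case False
  then show ?thesis using assms unfolding sym_pos_def_def inner_H_def by fastforce
qed

lemma norm_H_squared:
  assumes "sym_pos_def N H" "x \<in> carrier_vec N"
  shows "(norm_H H x)\<^sup>2 = inner_H H x x"
  using inner_H_nonneg[OF assms] unfolding norm_H_def by simp

lemma inner_H_sum_left:
  assumes "H \<in> carrier_mat N N" "y \<in> carrier_vec N" "\<And>k. v k \<in> carrier_vec N"
  shows "inner_H H (vec N (\<lambda>r. \<Sum>k\<le>s. c k * v k $ r)) y = (\<Sum>k\<le>s. c k * inner_H H (v k) y)"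
proof -
  have "inner_H H (vec N (\<lambda>r. \<Sum>k\<le>s. c k * v k $ r)) y
      = (\<Sum>r = 0..<N. \<Sum>k\<le>s. c k * (v k $ r * (H *\<^sub>v y) $ r))"
    using assms unfolding inner_H_def scalar_prod_def
    by (simp add: sum_distrib_right mult.assoc)
  also have "\<dots> = (\<Sum>k\<le>s. \<Sum>r = 0..<N. c k * (v k $ r * (H *\<^sub>v y) $ r))"
    by (rule sum.swap)
  also have "\<dots> = (\<Sum>k\<le>s. c k * inner_H H (v k) y)"
    using assms(1) unfolding inner_H_def scalar_prod_def by (simp add: sum_distrib_left)
  finally show ?thesis .
qed

lemma semi_inner_H_eq:
  assumes "H \<in> carrier_mat N N" "L \<in> carrier_mat N N" "x \<in> carrier_vec N" "y \<in> carrier_vec N"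
  shows "semi_inner_H H L x y = - (inner_H H (L *\<^sub>v x) y + inner_H H x (L *\<^sub>v y))"
proof -
  have "(transpose_mat L * H + H * L) *\<^sub>v y
      = transpose_mat L *\<^sub>v (H *\<^sub>v y) + H *\<^sub>v (L *\<^sub>v y)"
    using assms by (simp add: add_mult_distrib_mat_vec[of _ N N] assoc_mult_mat_vec[of _ N N _ N])
  moreover have "x \<bullet> (transpose_mat L *\<^sub>v (H *\<^sub>v y) + H *\<^sub>v (L *\<^sub>v y))
      = x \<bullet> (transpose_mat L *\<^sub>v (H *\<^sub>v y)) + x \<bullet> (H *\<^sub>v (L *\<^sub>v y))"
    using assms by (intro scalar_prod_add_distrib[of _ N]) auto
  moreover have "x \<bullet> (transpose_mat L *\<^sub>v (H *\<^sub>v y)) = (L *\<^sub>v x) \<bullet> (H *\<^sub>v y)"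
    using transpose_vec_mult_scalar[of "transpose_mat L" N N "H *\<^sub>v y" x] assms by simp
  ultimately show ?thesis
    unfolding semi_inner_H_def inner_H_def by simp
qed

lemma pow_mat_Suc_mult_vec:
  assumes "L \<in> carrier_mat N N" "u \<in> carrier_vec N"
  shows "(L ^\<^sub>m Suc k) *\<^sub>v u = L *\<^sub>v ((L ^\<^sub>m k) *\<^sub>v u)"
proof -
  have "L ^\<^sub>m k * L = L * L ^\<^sub>m k"
  proof (induction k)
    case 0
    then show ?case using assms by simp
  next
    case (Suc k)
    then show ?case
      using assms assoc_mult_mat[of L N N "L ^\<^sub>m k" N L N] by simp
  qed
  then show ?thesis
    using assms assoc_mult_mat_vec[of L N N "L ^\<^sub>m k" N u] by simp
qed

lemma pow_smult_mat:
  assumes "L \<in> carrier_mat N N"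
  shows "(t \<cdot>\<^sub>m L) ^\<^sub>m k = (t ^ k :: real) \<cdot>\<^sub>m (L ^\<^sub>m k)"
proof (induction k)
  case 0
  show ?case using assms by (intro eq_matI) auto
next
  case (Suc k)
  have "(t ^ k \<cdot>\<^sub>m (L ^\<^sub>m k)) * (t \<cdot>\<^sub>m L) = t \<cdot>\<^sub>m (t ^ k \<cdot>\<^sub>m (L ^\<^sub>m k * L))"
    using assms by (simp add: mult_smult_distrib[of _ N N _ N] mult_smult_assoc_mat[of _ N N _ N])
  also have "\<dots> = t ^ Suc k \<cdot>\<^sub>m (L ^\<^sub>m k * L)"
    by (intro eq_matI) (auto simp: mult.assoc)
  finally show ?case
    using Suc by simp
qed

lemma rk_operator_mult_vec:
  assumes "L \<in> carrier_mat N N" "u \<in> carrier_vec N"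
  shows "rk_operator s \<alpha> \<tau> L *\<^sub>v u
    = vec N (\<lambda>r. \<Sum>k\<le>s. (\<alpha> k * \<tau> ^ k) * ((L ^\<^sub>m k) *\<^sub>v u) $ r)"
proof (rule eq_vecI)
  fix r
  assume "r < dim_vec (vec N (\<lambda>r. \<Sum>k\<le>s. (\<alpha> k * \<tau> ^ k) * ((L ^\<^sub>m k) *\<^sub>v u) $ r))"
  then have r: "r < N" by simp
  have L: "dim_row L = N" "dim_col L = N" "dim_vec u = N" using assms by auto
  have dims: "dim_row (L ^\<^sub>m k) = N" "dim_col (L ^\<^sub>m k) = N" for k
    using pow_carrier_mat[OF assms(1), of k] by auto
  have "(rk_operator s \<alpha> \<tau> L *\<^sub>v u) $ r
      = (\<Sum>q = 0..<N. \<Sum>k\<le>s. (\<alpha> k * \<tau> ^ k) * ((L ^\<^sub>m k) $$ (r, q) * u $ q))"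
    using r L dims unfolding rk_operator_def
    by (simp add: scalar_prod_def pow_smult_mat[OF assms(1)] sum_distrib_right mult.assoc)
  also have "\<dots> = (\<Sum>k\<le>s. \<Sum>q = 0..<N. (\<alpha> k * \<tau> ^ k) * ((L ^\<^sub>m k) $$ (r, q) * u $ q))"
    by (rule sum.swap)
  also have "\<dots> = (\<Sum>k\<le>s. (\<alpha> k * \<tau> ^ k) * ((L ^\<^sub>m k) *\<^sub>v u) $ r)"
    using r L dims by (simp add: scalar_prod_def sum_distrib_left)
  finally show "(rk_operator s \<alpha> \<tau> L *\<^sub>v u) $ r
      = vec N (\<lambda>r. \<Sum>k\<le>s. (\<alpha> k * \<tau> ^ k) * ((L ^\<^sub>m k) *\<^sub>v u) $ r) $ r"
    using r by simp
qed (use assms in \<open>simp add: rk_operator_def\<close>)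

lemma energy_coeffs_exist: "\<exists>\<beta> \<gamma>. energy_coeffs s \<alpha> \<beta> \<gamma>"
proof -
  obtain \<beta> \<gamma> where sym: "\<And>i j. \<gamma> i j = \<gamma> j i"
    and form: "\<And>a. (\<forall>i j. a i j = a j i) \<Longrightarrow>
      (\<Sum>i\<le>s. \<Sum>j\<le>s. \<alpha> i * \<alpha> j * a i j) = energy_form s \<beta> \<gamma> a"
    using quadratic_reducible[of s \<alpha>] unfolding reducible_form_def by blast
  have "(norm_H H (rk_operator s \<alpha> \<tau> L *\<^sub>v u))\<^sup>2 =
          (\<Sum>k\<le>s. \<beta> k * \<tau> ^ (2 * k) * (norm_H H ((L ^\<^sub>m k) *\<^sub>v u))\<^sup>2) +
          (\<Sum>i<s. \<Sum>j<s. \<gamma> i j * \<tau> ^ (i + j + 1) *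
             semi_inner_H H L ((L ^\<^sub>m i) *\<^sub>v u) ((L ^\<^sub>m j) *\<^sub>v u))"
    if SPD: "sym_pos_def N H" and neg: "semi_negative N H L" and u: "u \<in> carrier_vec N"
    for N H L u \<tau>
  proof -
    have H: "H \<in> carrier_mat N N" using SPD unfolding sym_pos_def_def by auto
    have L: "L \<in> carrier_mat N N" using neg unfolding semi_negative_def by auto
    define v where "v k = (L ^\<^sub>m k) *\<^sub>v u" for k
    have v: "v k \<in> carrier_vec N" for k
      unfolding v_def using pow_carrier_mat[OF L, of k] u by auto
    have v_Suc: "v (Suc k) = L *\<^sub>v v k" for k
      unfolding v_def by (rule pow_mat_Suc_mult_vec[OF L u])
    define a where "a i j = \<tau> ^ (i + j) * inner_H H (v i) (v j)" for i j
    have a_sym: "a i j = a j i" for i j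
      unfolding a_def inner_H_commute[OF SPD v[of i] v[of j]] add.commute[of i j] ..
    define w where "w = vec N (\<lambda>r. \<Sum>k\<le>s. (\<alpha> k * \<tau> ^ k) * v k $ r)"
    have w: "w \<in> carrier_vec N" unfolding w_def by simp
    have "(norm_H H (rk_operator s \<alpha> \<tau> L *\<^sub>v u))\<^sup>2 = inner_H H w w"
      unfolding rk_operator_mult_vec[OF L u] v_def[symmetric] w_def[symmetric]
      by (rule norm_H_squared[OF SPD w])
    also have "\<dots> = (\<Sum>i\<le>s. (\<alpha> i * \<tau> ^ i) * inner_H H (v i) w)"
      by (subst (1) w_def) (rule inner_H_sum_left[OF H w v])
    also have "\<dots> = (\<Sum>i\<le>s. (\<alpha> i * \<tau> ^ i) * (\<Sum>j\<le>s. (\<alpha> j * \<tau> ^ j) * inner_H H (v j) (v i)))"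
    proof -
      have "inner_H H (v i) w = (\<Sum>j\<le>s. (\<alpha> j * \<tau> ^ j) * inner_H H (v j) (v i))" for i
        unfolding inner_H_commute[OF SPD v[of i] w] unfolding w_def by (rule inner_H_sum_left[OF H v v])
      then show ?thesis by simp
    qed
    also have "\<dots> = (\<Sum>i\<le>s. \<Sum>j\<le>s. \<alpha> i * \<alpha> j * a i j)"
    proof -
      have "(\<alpha> i * \<tau> ^ i) * ((\<alpha> j * \<tau> ^ j) * inner_H H (v j) (v i)) = \<alpha> i * \<alpha> j * a i j" for i j
        unfolding a_def inner_H_commute[OF SPD v[of i] v[of j]] by (simp add: power_add)
      then show ?thesis unfolding sum_distrib_left by (intro sum.cong refl)
    qed
    also have "\<dots> = energy_form s \<beta> \<gamma> a"
      by (rule form) (use a_sym in blast)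
    also have "\<dots> = (\<Sum>k\<le>s. \<beta> k * \<tau> ^ (2 * k) * (norm_H H (v k))\<^sup>2) +
        (\<Sum>i<s. \<Sum>j<s. \<gamma> i j * \<tau> ^ (i + j + 1) * semi_inner_H H L (v i) (v j))"
    proof -
      have "a k k = \<tau> ^ (2 * k) * (norm_H H (v k))\<^sup>2" for k
        unfolding a_def norm_H_squared[OF SPD v] by (simp add: mult_2)
      moreover have "- (a (Suc i) j + a i (Suc j)) = \<tau> ^ (i + j + 1) * semi_inner_H H L (v i) (v j)"
        for i j
        unfolding a_def semi_inner_H_eq[OF H L v v] v_Suc by (simp add: algebra_simps)
      ultimately show ?thesis
        unfolding energy_form_def by (simp only: mult.assoc)
    qed
    finally show ?thesis unfolding v_def .
  qed
  then show ?thesis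
    unfolding energy_coeffs_def using sym
    by (intro exI[of _ \<beta>] exI[of _ \<gamma>]) blast
qed

end

theory Submission
  imports Defs "Jordan_Normal_Form.Determinant"
begin

text \<open>If \<open>L\<close> is skew with respect to \<open>H\<close>, the energy equality reduces to
  \<open>\<parallel>R u\<parallel>\<^sup>2 = \<parallel>u\<parallel>\<^sup>2 + \<Sum>j\<ge>k. \<beta> j * \<parallel>(\<tau> L)\<^sup>j u\<parallel>\<^sup>2\<close>, because the constant coefficient is 1 (take \<open>L = 0\<close>).
  For \<open>\<tau> \<parallel>L\<parallel>\<close> small the terms beyond the leading one are dominated by
  \<open>\<beta> k * \<parallel>(\<tau> L)\<^sup>k u\<parallel>\<^sup>2\<close>, so \<open>\<parallel>R u\<parallel> > \<parallel>u\<parallel>\<close> as soon as \<open>L\<^sup>k u \<noteq> 0\<close>. A skew operator has no nilpotent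
  part, so any \<open>u\<close> with \<open>L u \<noteq> 0\<close> will do.\<close>

section \<open>Algebra of the inner product and norm given by \<open>H\<close>\<close>

lemma mult_mat_zero_vec [simp]:
  "A \<in> carrier_mat nr nc \<Longrightarrow> A *\<^sub>v 0\<^sub>v nc = (0\<^sub>v nr :: 'a :: semiring_0 vec)"
  by (intro eq_vecI) auto

lemma zero_mat_mult_vec [simp]:
  "v \<in> carrier_vec nc \<Longrightarrow> 0\<^sub>m nr nc *\<^sub>v v = (0\<^sub>v nr :: 'a :: semiring_0 vec)"
  by (intro eq_vecI) auto

lemma sym_pos_def_carrier: "sym_pos_def N H \<Longrightarrow> H \<in> carrier_mat N N"
  unfolding sym_pos_def_def by blast

lemma norm_H_nonneg: "sym_pos_def N H \<Longrightarrow> x \<in> carrier_vec N \<Longrightarrow> 0 \<le> norm_H H x"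
  unfolding norm_H_def by (simp add: inner_H_nonneg)

lemma norm_H_pos:
  assumes "sym_pos_def N H" "x \<in> carrier_vec N" "x \<noteq> 0\<^sub>v N"
  shows "0 < norm_H H x"
  using assms unfolding norm_H_def inner_H_def sym_pos_def_def by simp

lemma norm_H_zero: "H \<in> carrier_mat N N \<Longrightarrow> norm_H H (0\<^sub>v N) = 0"
  unfolding norm_H_def inner_H_def by simp

lemma inner_H_smult:
  assumes "H \<in> carrier_mat N N" "x \<in> carrier_vec N" "y \<in> carrier_vec N"
  shows "inner_H H (a \<cdot>\<^sub>v x) (b \<cdot>\<^sub>v y) = a * b * inner_H H x y"
  using assms unfolding inner_H_def by (simp add: mult_mat_vec)

lemma norm_H_smult:
  assumes "H \<in> carrier_mat N N" "x \<in> carrier_vec N"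
  shows "norm_H H (a \<cdot>\<^sub>v x) = \<bar>a\<bar> * norm_H H x"
  unfolding norm_H_def inner_H_smult[OF assms assms(2)] by (simp add: real_sqrt_mult)

lemma inner_H_diff_left:
  assumes "H \<in> carrier_mat N N" "x \<in> carrier_vec N" "y \<in> carrier_vec N" "z \<in> carrier_vec N"
  shows "inner_H H (x - y) z = inner_H H x z - inner_H H y z"
  using assms unfolding inner_H_def by (simp add: minus_scalar_prod_distrib[of _ N])

section \<open>Cauchy-Schwarz and the induced operator norm\<close>

text \<open>Expand the squared norm of \<open>z\<close>, the component of \<open>x\<close>
  orthogonal to \<open>y\<close>, scaled by \<open>p\<close> to avoid division. Orthogonality leaves
  only \<open>p * (p * inner_H H x x - q^2)\<close>, which must be nonnegative.\<close>

lemma inner_H_Cauchy_Schwarz: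
  assumes S: "sym_pos_def N H" and x: "x \<in> carrier_vec N" and y: "y \<in> carrier_vec N"
  shows "\<bar>inner_H H x y\<bar> \<le> norm_H H x * norm_H H y"
proof (cases "y = 0\<^sub>v N")
  case True
  then show ?thesis
    using sym_pos_def_carrier[OF S] x by (simp add: norm_H_zero) (simp add: inner_H_def)
next
  case False
  note H = sym_pos_def_carrier[OF S]
  define p q where "p = inner_H H y y" and "q = inner_H H x y"
  have p: "0 < p" using S y False unfolding p_def inner_H_def sym_pos_def_def by blast
  define z where "z = p \<cdot>\<^sub>v x - q \<cdot>\<^sub>v y"
  have z: "z \<in> carrier_vec N" unfolding z_def using x y by simp
  have left: "inner_H H z w = p * inner_H H x w - q * inner_H H y w" if "w \<in> carrier_vec N" for w
    using inner_H_diff_left[OF H, of "p \<cdot>\<^sub>v x" "q \<cdot>\<^sub>v y" w] that x y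
      inner_H_smult[OF H x that, of p 1] inner_H_smult[OF H y that, of q 1]
    unfolding z_def by simp
  have zx: "inner_H H z x = p * inner_H H x x - q\<^sup>2"
    using left[OF x] inner_H_commute[OF S x y] by (simp add: q_def power2_eq_square)
  have zy: "inner_H H z y = 0"
    using left[OF y] by (simp add: p_def q_def)
  have "inner_H H z z = p * inner_H H x z - q * inner_H H y z"
    by (rule left[OF z])
  also have "\<dots> = p * (p * inner_H H x x - q\<^sup>2)"
    unfolding inner_H_commute[OF S x z] inner_H_commute[OF S y z] zx zy by simp
  finally have "0 \<le> p * (p * inner_H H x x - q\<^sup>2)"
    using inner_H_nonneg[OF S z] by simp
  then have "q\<^sup>2 \<le> inner_H H x x * p"
    using p by (simp add: zero_le_mult_iff mult.commute)
  then show ?thesis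
    unfolding norm_H_def p_def[symmetric] q_def[symmetric] real_sqrt_mult[symmetric]
    by (metis real_sqrt_abs real_sqrt_le_mono)
qed

text \<open>Via the Riesz representation: coordinate \<open>i\<close> is the \<open>H\<close>-inner product with the \<open>i\<close>-th column of
  the inverse of \<open>H\<close>.\<close>

lemma coordinate_bound_H:
  assumes S: "sym_pos_def N H"
  obtains C where "\<And>i. 0 \<le> C i"
    "\<And>i v. i < N \<Longrightarrow> v \<in> carrier_vec N \<Longrightarrow> \<bar>v $ i\<bar> \<le> C i * norm_H H v"
proof -
  note H = sym_pos_def_carrier[OF S]
  have "det H \<noteq> 0"
  proof
    assume "det H = 0"
    then obtain v where v: "v \<in> carrier_vec N" "v \<noteq> 0\<^sub>v N" "H *\<^sub>v v = 0\<^sub>v N"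
      using det_0_iff_vec_prod_zero[OF H] by blast
    then have "0 < v \<bullet> (H *\<^sub>v v)" using S unfolding sym_pos_def_def by blast
    then show False using v by simp
  qed
  \<comment> \<open>The argument \<open>()\<close> only fills the record extension of
    \<open>ring_mat\<close>; what matters is the inverse matrix \<open>B\<close>.\<close>
  from det_non_zero_imp_unit[OF H this, of "()"]
  obtain B where B: "B \<in> carrier_mat N N" "H * B = 1\<^sub>m N"
    unfolding Units_def ring_mat_def by auto
  have b: "B *\<^sub>v unit_vec N i \<in> carrier_vec N" for i
    using B by simp
  have coord: "v $ i = inner_H H v (B *\<^sub>v unit_vec N i)" if "i < N" "v \<in> carrier_vec N" for i v
  proof -
    have "H *\<^sub>v (B *\<^sub>v unit_vec N i) = unit_vec N i"
      using H B by (simp add: assoc_mult_mat_vec[symmetric, of _ N N _ N])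
    then show ?thesis unfolding inner_H_def using that by simp
  qed
  show ?thesis
  proof (rule that[of "\<lambda>i. norm_H H (B *\<^sub>v unit_vec N i)"])
    show "0 \<le> norm_H H (B *\<^sub>v unit_vec N i)" for i by (rule norm_H_nonneg[OF S b])
    show "\<bar>v $ i\<bar> \<le> norm_H H (B *\<^sub>v unit_vec N i) * norm_H H v"
      if "i < N" "v \<in> carrier_vec N" for i v
      using inner_H_Cauchy_Schwarz[OF S that(2) b[of i]] coord[OF that] by (simp add: mult.commute)
  qed
qed

lemma bdd_above_opnorm_H:
  assumes S: "sym_pos_def N H" and A: "A \<in> carrier_mat N N"
  shows "bdd_above {norm_H H (A *\<^sub>v v) | v. v \<in> carrier_vec N \<and> norm_H H v \<le> 1}"
proof -
  note H = sym_pos_def_carrier[OF S]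
  obtain C where C: "\<And>i. 0 \<le> C i"
    "\<And>i v. i < N \<Longrightarrow> v \<in> carrier_vec N \<Longrightarrow> \<bar>v $ i\<bar> \<le> C i * norm_H H v"
    using coordinate_bound_H[OF S] by blast
  \<comment> \<open>The form of \<open>M\<close> at \<open>v\<close> is the squared norm of the
    image of \<open>v\<close> under \<open>A\<close>, now expressed through the coordinates of
    \<open>v\<close>.\<close>
  define M where "M = transpose_mat A * H * A"
  have M: "M \<in> carrier_mat N N" unfolding M_def using A H by simp
  have "norm_H H (A *\<^sub>v v) \<le> sqrt (\<Sum>i<N. \<Sum>j<N. C i * (\<bar>M $$ (i, j)\<bar> * C j))"
    if v: "v \<in> carrier_vec N" and n: "norm_H H v \<le> 1" for v
  proof -
    have c: "\<bar>v $ i\<bar> \<le> C i" if "i < N" for i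
      using C(2)[OF that v] mult_left_mono[OF n C(1)[of i]] by simp
    have "M *\<^sub>v v = transpose_mat A *\<^sub>v (H *\<^sub>v (A *\<^sub>v v))"
      unfolding M_def using A H v by (simp add: assoc_mult_mat_vec[of _ N N _ N])
    then have "inner_H H (A *\<^sub>v v) (A *\<^sub>v v) = v \<bullet> (M *\<^sub>v v)"
      using transpose_vec_mult_scalar[of "transpose_mat A" N N "H *\<^sub>v (A *\<^sub>v v)" v] A H v
      unfolding inner_H_def by simp
    also have "\<dots> = (\<Sum>i<N. \<Sum>j<N. v $ i * (M $$ (i, j) * v $ j))"
      using M v by (simp add: scalar_prod_def sum_distrib_left atLeast0LessThan)
    also have "\<dots> \<le> (\<Sum>i<N. \<Sum>j<N. C i * (\<bar>M $$ (i, j)\<bar> * C j))"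
    proof (intro sum_mono)
      fix i j assume ij: "i \<in> {..<N}" "j \<in> {..<N}"
      have "v $ i * (M $$ (i, j) * v $ j) \<le> \<bar>v $ i\<bar> * (\<bar>M $$ (i, j)\<bar> * \<bar>v $ j\<bar>)"
        by (metis abs_ge_self abs_mult)
      also have "\<dots> \<le> C i * (\<bar>M $$ (i, j)\<bar> * C j)"
        using ij c C(1) by (intro mult_mono) auto
      finally show "v $ i * (M $$ (i, j) * v $ j) \<le> C i * (\<bar>M $$ (i, j)\<bar> * C j)" .
    qed
    finally show ?thesis unfolding norm_H_def by simp
  qed
  then show ?thesis by (intro bdd_aboveI) blast
qed

lemma norm_H_mult_vec_le:
  assumes S: "sym_pos_def N H" and A: "A \<in> carrier_mat N N" and v: "v \<in> carrier_vec N"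
  shows "norm_H H (A *\<^sub>v v) \<le> opnorm_H H A * norm_H H v"
proof (cases "v = 0\<^sub>v N")
  case True
  then show ?thesis using sym_pos_def_carrier[OF S] A by (simp add: norm_H_zero)
next
  case False
  note H = sym_pos_def_carrier[OF S]
  define r where "r = norm_H H v"
  have r: "0 < r" unfolding r_def by (rule norm_H_pos[OF S v False])
  define w where "w = (1 / r) \<cdot>\<^sub>v v"
  have w: "w \<in> carrier_vec N" unfolding w_def using v by simp
  have "norm_H H w \<le> 1"
    unfolding w_def norm_H_smult[OF H v] r_def[symmetric] using r by simp
  then have "norm_H H (A *\<^sub>v w) \<le> opnorm_H H A"
    unfolding opnorm_H_def using H w bdd_above_opnorm_H[OF S A]
    by (intro cSup_upper) auto
  moreover have "A *\<^sub>v w = (1 / r) \<cdot>\<^sub>v (A *\<^sub>v v)"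
    unfolding w_def using A v by (rule mult_mat_vec)
  ultimately have "norm_H H (A *\<^sub>v v) / r \<le> opnorm_H H A"
    using norm_H_smult[OF H, of "A *\<^sub>v v" "1 / r"] A v r by simp
  then show ?thesis using r unfolding r_def[symmetric] by (simp add: field_simps)
qed

text \<open>Lets a smallness condition that excludes norm 0 produce a test vector, and conversely
  lets a single nonzero image certify a positive norm.\<close>

lemma opnorm_H_pos_iff:
  assumes S: "sym_pos_def N H" and A: "A \<in> carrier_mat N N"
  shows "0 < opnorm_H H A \<longleftrightarrow> (\<exists>u \<in> carrier_vec N. A *\<^sub>v u \<noteq> 0\<^sub>v N)"
proof
  note H = sym_pos_def_carrier[OF S]
  assume pos: "0 < opnorm_H H A"
  show "\<exists>u \<in> carrier_vec N. A *\<^sub>v u \<noteq> 0\<^sub>v N"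
  proof (rule ccontr)
    assume "\<not> ?thesis"
    \<comment> \<open>The zero vector shows the set nonempty, which bounding its supremum from above
      requires.\<close>
    then have "opnorm_H H A \<le> 0"
      unfolding opnorm_H_def using H by (intro cSup_least) (auto simp: norm_H_zero intro!: exI[of _ "0\<^sub>v N"])
    with pos show False by simp
  qed
next
  assume "\<exists>u \<in> carrier_vec N. A *\<^sub>v u \<noteq> 0\<^sub>v N"
  then obtain u where u: "u \<in> carrier_vec N" "A *\<^sub>v u \<noteq> 0\<^sub>v N" by blast
  have "A *\<^sub>v u \<in> carrier_vec N" using A u by simp
  from norm_H_pos[OF S this u(2)] norm_H_mult_vec_le[OF S A u(1)]
  have "0 < opnorm_H H A * norm_H H u" by linarith
  then show "0 < opnorm_H H A"
    using norm_H_nonneg[OF S u(1)] by (simp add: zero_less_mult_iff)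
qed

section \<open>Skew operators and the energy equality\<close>

lemma skew_inner_H:
  assumes H: "H \<in> carrier_mat N N" and L: "L \<in> carrier_mat N N"
    and skew: "transpose_mat L * H + H * L = 0\<^sub>m N N"
    and x: "x \<in> carrier_vec N" and y: "y \<in> carrier_vec N"
  shows "inner_H H (L *\<^sub>v x) y = - inner_H H x (L *\<^sub>v y)"
proof -
  have "semi_inner_H H L x y = 0"
    unfolding semi_inner_H_def skew using x y by simp
  then show ?thesis using semi_inner_H_eq[OF H L x y] by simp
qed

text \<open>Moving one factor \<open>L\<close> across the inner product gives, up to sign, the
  squared norm of \<open>v (Suc k)\<close> as the product of \<open>v k\<close> with
  \<open>v (Suc (Suc k))\<close>. So one nonzero iterate forces the next to be nonzero.\<close>

lemma skew_pow_nonzero: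
  assumes S: "sym_pos_def N H" and L: "L \<in> carrier_mat N N"
    and skew: "transpose_mat L * H + H * L = 0\<^sub>m N N"
    and u: "u \<in> carrier_vec N" and Lu: "L *\<^sub>v u \<noteq> 0\<^sub>v N"
  shows "(L ^\<^sub>m k) *\<^sub>v u \<noteq> 0\<^sub>v N"
proof -
  note H = sym_pos_def_carrier[OF S]
  define v where "v k = (L ^\<^sub>m k) *\<^sub>v u" for k
  have v: "v k \<in> carrier_vec N" for k
    unfolding v_def using pow_carrier_mat[OF L, of k] u by auto
  have v_Suc: "v (Suc k) = L *\<^sub>v v k" for k
    unfolding v_def by (rule pow_mat_Suc_mult_vec[OF L u])
  have v0: "v 0 = u" unfolding v_def using L u by simp
  have "v (Suc k) \<noteq> 0\<^sub>v N" for k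
  proof (induction k)
    case 0
    then show ?case using Lu by (simp add: v_Suc v0)
  next
    case (Suc k)
    have "0 < inner_H H (L *\<^sub>v v k) (v (Suc k))"
      using S v[of "Suc k"] Suc unfolding v_Suc[symmetric] inner_H_def sym_pos_def_def by blast
    then have "inner_H H (v k) (v (Suc (Suc k))) \<noteq> 0"
      using skew_inner_H[OF H L skew v v, of k "Suc k"] by (simp add: v_Suc)
    moreover have "inner_H H (v k) (0\<^sub>v N) = 0"
      unfolding inner_H_def using H v[of k] by simp
    ultimately show ?case by metis
  qed
  \<comment> \<open>Exponent 0 is separate: \<open>u\<close> itself is nonzero because its image
    under \<open>L\<close> is.\<close>
  then have "v k \<noteq> 0\<^sub>v N"
    using Lu u by (cases k) (auto simp: v0 L)
  then show ?thesis unfolding v_def .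
qed

lemma sym_pos_def_one: "sym_pos_def N (1\<^sub>m N)"
  unfolding sym_pos_def_def
proof (intro conjI ballI impI)
  fix v :: "real vec"
  assume v: "v \<in> carrier_vec N" "v \<noteq> 0\<^sub>v N"
  then obtain i where i: "i < N" "v $ i \<noteq> 0" by (metis carrier_vecD eq_vecI index_zero_vec)
  have "0 < (\<Sum>i<N. v $ i * v $ i)"
    by (rule sum_pos2[of _ i]) (use i in \<open>auto simp: zero_less_mult_iff\<close>)
  then show "0 < v \<bullet> (1\<^sub>m N *\<^sub>v v)"
    using v by (simp add: scalar_prod_def atLeast0LessThan)
qed simp_all

text \<open>Skewness is the equality case of semi-negativity, so the energy equality applies and
  every \<open>semi_inner_H\<close> term vanishes.\<close>

lemma skew_energy:
  assumes coeffs: "energy_coeffs s \<alpha> \<beta> \<gamma>"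
    and S: "sym_pos_def N H" and L: "L \<in> carrier_mat N N"
    and skew: "transpose_mat L * H + H * L = 0\<^sub>m N N"
    and u: "u \<in> carrier_vec N" and \<tau>: "0 < \<tau>"
  shows "(norm_H H (rk_operator s \<alpha> \<tau> L *\<^sub>v u))\<^sup>2 =
    (\<Sum>j\<le>s. \<beta> j * \<tau> ^ (2 * j) * (norm_H H ((L ^\<^sub>m j) *\<^sub>v u))\<^sup>2)"
proof -
  have "semi_negative N H L"
    unfolding semi_negative_def skew using L by simp
  then have "(norm_H H (rk_operator s \<alpha> \<tau> L *\<^sub>v u))\<^sup>2 =
          (\<Sum>j\<le>s. \<beta> j * \<tau> ^ (2 * j) * (norm_H H ((L ^\<^sub>m j) *\<^sub>v u))\<^sup>2) +
          (\<Sum>i<s. \<Sum>j<s. \<gamma> i j * \<tau> ^ (i + j + 1) *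
             semi_inner_H H L ((L ^\<^sub>m i) *\<^sub>v u) ((L ^\<^sub>m j) *\<^sub>v u))"
    using coeffs S u \<tau> unfolding energy_coeffs_def by blast
  moreover have "(L ^\<^sub>m j) *\<^sub>v u \<in> carrier_vec N" for j
    using pow_carrier_mat[OF L, of j] u by auto
  then have "semi_inner_H H L ((L ^\<^sub>m i) *\<^sub>v u) ((L ^\<^sub>m j) *\<^sub>v u) = 0" for i j
    unfolding semi_inner_H_def skew by simp
  ultimately show ?thesis by simp
qed

text \<open>The coefficients are known only through the identities they satisfy, so they are tested
  in dimension 1 with time step 1: both sides keep only their index 0 term, a multiple of a nonzero
  squared norm.\<close>

lemma energy_coeffs_zero:
  assumes "energy_coeffs s \<alpha> \<beta> \<gamma>" and "\<alpha> 0 = 1"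
  shows "\<beta> 0 = 1"
proof -
  define u :: "real vec" where "u = unit_vec 1 0"
  have u: "u \<in> carrier_vec 1" unfolding u_def by simp
  define L :: "real mat" where "L = 0\<^sub>m 1 1"
  have L: "L \<in> carrier_mat 1 1" unfolding L_def by simp
  define H :: "real mat" where "H = 1\<^sub>m 1"
  have S: "sym_pos_def 1 H" unfolding H_def by (rule sym_pos_def_one)
  note H = sym_pos_def_carrier[OF S]
  have skew: "transpose_mat L * H + H * L = 0\<^sub>m 1 1"
    unfolding L_def H_def by simp
  have pow: "(L ^\<^sub>m k) *\<^sub>v u = (if k = 0 then u else 0\<^sub>v 1)" for k
  proof (cases k)
    case (Suc m)
    have "(L ^\<^sub>m m) *\<^sub>v u \<in> carrier_vec 1"
      using pow_carrier_mat[OF L, of m] u by auto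
    then show ?thesis
      unfolding Suc pow_mat_Suc_mult_vec[OF L u] by (simp add: L_def)
  qed (use L u in simp)
  have "(\<Sum>k\<le>s. (\<alpha> k * 1 ^ k) * ((L ^\<^sub>m k) *\<^sub>v u) $ r) = (\<Sum>k\<le>s. if k = 0 then u $ r else 0)"
    if "r < 1" for r
    unfolding pow using that assms(2) by (intro sum.cong) auto
  then have "rk_operator s \<alpha> 1 L *\<^sub>v u = u"
    unfolding rk_operator_mult_vec[OF L u] using u by (intro eq_vecI) auto
  moreover have "(norm_H H (rk_operator s \<alpha> 1 L *\<^sub>v u))\<^sup>2 =
      (\<Sum>k\<le>s. \<beta> k * 1 ^ (2 * k) * (norm_H H ((L ^\<^sub>m k) *\<^sub>v u))\<^sup>2)"
    using assms(1) S L skew u by (rule skew_energy) simp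
  moreover have "(\<Sum>k\<le>s. \<beta> k * 1 ^ (2 * k) * (norm_H H ((L ^\<^sub>m k) *\<^sub>v u))\<^sup>2)
      = (\<Sum>k\<le>s. if k = 0 then \<beta> 0 * (norm_H H u)\<^sup>2 else 0)"
    unfolding pow by (intro sum.cong) (simp_all add: norm_H_zero[OF H, simplified])
  ultimately have "(norm_H H u)\<^sup>2 = \<beta> 0 * (norm_H H u)\<^sup>2" by simp
  moreover have "0 < norm_H H u"
    by (rule norm_H_pos[OF S u]) (simp add: u_def)
  ultimately show ?thesis by simp
qed

section \<open>Growth caused by the leading coefficient\<close>

lemma leading_term_dominates:
  fixes \<beta> a :: "nat \<Rightarrow> real"
  assumes lead: "leading_index s \<beta> k" and \<beta>0: "\<beta> 0 = 1" and ak: "0 < a k"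
    and c: "0 \<le> c" "c * (\<Sum>j\<le>s. \<bar>\<beta> j\<bar>) < \<beta> k"
    and tail: "\<And>j. k < j \<Longrightarrow> a j \<le> c * a k" and nonneg: "\<And>j. 0 \<le> a j"
  shows "a 0 < (\<Sum>j\<le>s. \<beta> j * a j)"
proof -
  have k: "1 \<le> k" "k \<le> s" and small: "\<And>j. 1 \<le> j \<Longrightarrow> j < k \<Longrightarrow> \<beta> j = 0"
    using lead unfolding leading_index_def by auto
  \<comment> \<open>The penalty \<open>c * a k * \<bar>\<beta> j\<bar>\<close> is charged at every
    index, not only beyond \<open>k\<close>, so that the total involves the full sum bounded in the
    assumption on \<open>c\<close>.\<close>
  have "(\<Sum>j\<le>s. (if j = 0 then a 0 else 0) + (if j = k then \<beta> k * a k else 0) - c * a k * \<bar>\<beta> j\<bar>)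
      \<le> (\<Sum>j\<le>s. \<beta> j * a j)"
  proof (rule sum_mono)
    fix j
    have pos: "0 \<le> c * a k * \<bar>\<beta> j\<bar>" using c(1) ak by simp
    consider "j = 0" | "1 \<le> j" "j < k" | "j = k" | "k < j" by linarith
    then show "(if j = 0 then a 0 else 0) + (if j = k then \<beta> k * a k else 0) - c * a k * \<bar>\<beta> j\<bar>
        \<le> \<beta> j * a j"
    proof cases
      case 4
      have "- (\<beta> j * a j) \<le> \<bar>\<beta> j\<bar> * a j"
        using nonneg[of j] by (metis abs_ge_minus_self abs_mult abs_of_nonneg)
      also have "\<dots> \<le> \<bar>\<beta> j\<bar> * (c * a k)"
        using tail[OF 4] by (intro mult_left_mono) auto
      finally show ?thesis using 4 k by (simp add: mult.commute)
    qed (use k pos \<beta>0 small[of j] in auto)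
  qed
  also have "(\<Sum>j\<le>s. (if j = 0 then a 0 else 0) + (if j = k then \<beta> k * a k else 0) - c * a k * \<bar>\<beta> j\<bar>)
      = a 0 + (\<beta> k - c * (\<Sum>j\<le>s. \<bar>\<beta> j\<bar>)) * a k"
    using k by (simp add: sum.distrib sum_subtractf sum_distrib_left[symmetric] algebra_simps)
  finally show ?thesis using c(2) ak by (smt (verit) mult_pos_pos)
qed

lemma skew_energy_growth:
  assumes coeffs: "energy_coeffs s \<alpha> \<beta> \<gamma>" and \<beta>0: "\<beta> 0 = 1" and lead: "leading_index s \<beta> k"
    and c: "c \<le> 1" "c * (\<Sum>j\<le>s. \<bar>\<beta> j\<bar>) < \<beta> k"
    and S: "sym_pos_def N H" and L: "L \<in> carrier_mat N N"
    and skew: "transpose_mat L * H + H * L = 0\<^sub>m N N"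
    and \<tau>: "0 < \<tau>" "0 < \<tau> * opnorm_H H L" "\<tau> * opnorm_H H L \<le> c"
  shows "1 < opnorm_H H (rk_operator s \<alpha> \<tau> L)"
proof -
  have "0 < opnorm_H H L" using \<tau> by (simp add: zero_less_mult_iff)
  then obtain u where u: "u \<in> carrier_vec N" and Lu: "L *\<^sub>v u \<noteq> 0\<^sub>v N"
    using opnorm_H_pos_iff[OF S L] by blast
  define R where "R = rk_operator s \<alpha> \<tau> L"
  have R: "R \<in> carrier_mat N N" unfolding R_def rk_operator_def using L by simp
  define v where "v k = (L ^\<^sub>m k) *\<^sub>v u" for k
  have v: "v k \<in> carrier_vec N" for k
    unfolding v_def using pow_carrier_mat[OF L, of k] u by auto
  have v_Suc: "v (Suc k) = L *\<^sub>v v k" for k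
    unfolding v_def by (rule pow_mat_Suc_mult_vec[OF L u])
  have v0: "v 0 = u" unfolding v_def using L u by simp
  define a where "a j = (\<tau> ^ j * norm_H H (v j))\<^sup>2" for j
  have energy: "(norm_H H (R *\<^sub>v u))\<^sup>2 = (\<Sum>j\<le>s. \<beta> j * a j)"
    unfolding R_def skew_energy[OF coeffs S L skew u \<tau>(1)] a_def v_def
    by (simp add: power_mult_distrib mult.assoc flip: power_even_eq)
  have c0: "0 \<le> c" using \<tau> by linarith
  have a_nonneg: "0 \<le> a j" for j unfolding a_def by simp
  have a_Suc: "a (Suc j) \<le> c * a j" for j
  proof -
    define x where "x = \<tau> ^ j * norm_H H (v j)"
    have x: "0 \<le> x" unfolding x_def using \<tau>(1) norm_H_nonneg[OF S v] by simp
    have "\<tau> ^ Suc j * norm_H H (v (Suc j)) \<le> \<tau> ^ Suc j * (opnorm_H H L * norm_H H (v j))"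
      unfolding v_Suc using \<tau>(1) norm_H_mult_vec_le[OF S L v] by (intro mult_left_mono) auto
    also have "\<dots> = (\<tau> * opnorm_H H L) * x" unfolding x_def by simp
    also have "\<dots> \<le> c * x" using \<tau>(3) x by (rule mult_right_mono)
    finally have "a (Suc j) \<le> (c * x)\<^sup>2"
      unfolding a_def using \<tau>(1) norm_H_nonneg[OF S v] by (intro power_mono) auto
    also have "\<dots> = c * c * a j"
      unfolding a_def x_def by (simp add: power2_eq_square)
    \<comment> \<open>As \<open>c\<close> is at most 1, its square may be weakened to
      \<open>c\<close>, which keeps the smallness condition linear in \<open>c\<close>.\<close>
    also have "\<dots> \<le> c * a j"
      using c0 c(1) a_nonneg by (intro mult_right_mono) (auto simp: mult_left_le)
    finally show ?thesis .
  qed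
  have tail: "a j \<le> c * a k" if "k < j" for j
    using that
  proof (induction j rule: less_Suc_induct)
    case (1 i)
    then show ?case by (rule a_Suc)
  next
    case (2 i j l)
    have "c * a j \<le> a j" using c(1) a_nonneg by (simp add: mult_left_le_one_le c0)
    then show ?case using 2 by linarith
  qed
  have "v k \<noteq> 0\<^sub>v N"
    unfolding v_def by (rule skew_pow_nonzero[OF S L skew u Lu])
  then have ak: "0 < a k"
    unfolding a_def using norm_H_pos[OF S v[of k]] \<tau>(1) by simp
  have "a 0 < (\<Sum>j\<le>s. \<beta> j * a j)"
    by (rule leading_term_dominates[where c = c and a = a, OF lead \<beta>0 ak c0 c(2) tail a_nonneg])
  then have "(norm_H H u)\<^sup>2 < (norm_H H (R *\<^sub>v u))\<^sup>2"
    unfolding energy by (simp add: a_def v0)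
  moreover have "R *\<^sub>v u \<in> carrier_vec N" using R u by simp
  ultimately have "norm_H H u < norm_H H (R *\<^sub>v u)"
    using norm_H_nonneg[OF S] by (metis power_less_imp_less_base)
  also have "\<dots> \<le> opnorm_H H R * norm_H H u"
    by (rule norm_H_mult_vec_le[OF S R u])
  \<comment> \<open>An operator norm of at most 1 would contradict the strict growth of the norm of
    \<open>u\<close>.\<close>
  finally show ?thesis
    using norm_H_nonneg[OF S u] unfolding R_def[symmetric]
    by (metis linorder_not_less mult_left_le_one_le mult_right_mono mult_1)
qed

theorem theorem2p6:
  fixes s k :: nat
    and \<alpha> \<beta> :: "nat \<Rightarrow> real"
    and \<gamma> :: "nat \<Rightarrow> nat \<Rightarrow> real"
  assumes "rk_coeffs s \<alpha>"
    and "energy_coeffs s \<alpha> \<beta> \<gamma>"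
    and "leading_index s \<beta> k"
    and "\<beta> k > 0"
  shows "\<not> strongly_stable s \<alpha> \<and>
    (\<exists>c>0. \<forall>N H L \<tau>. sym_pos_def N H \<longrightarrow> L \<in> carrier_mat N N \<longrightarrow>
       transpose_mat L * H + H * L = 0\<^sub>m N N \<longrightarrow> 0 < \<tau> \<longrightarrow>
       0 < \<tau> * opnorm_H H L \<longrightarrow> \<tau> * opnorm_H H L \<le> c \<longrightarrow>
       1 < opnorm_H H (rk_operator s \<alpha> \<tau> L))"
proof -
  have \<beta>0: "\<beta> 0 = 1"
    using energy_coeffs_zero[OF assms(2)] assms(1) unfolding rk_coeffs_def by blast
  define B where "B = (\<Sum>j\<le>s. \<bar>\<beta> j\<bar>)"
  have "k \<le> s" using assms(3) unfolding leading_index_def by blast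
  then have B: "\<beta> k \<le> B"
    unfolding B_def using member_le_sum[of k "{..s}" "\<lambda>j. \<bar>\<beta> j\<bar>"] by auto
  \<comment> \<open>The summand 1 makes \<open>c * B\<close> strictly smaller than
    \<open>\<beta> k\<close>; \<open>B\<close> being at least \<open>\<beta> k\<close> gives
    \<open>c\<close> at most 1.\<close>
  define c where "c = \<beta> k / (B + 1)"
  have c: "0 < c" "c \<le> 1" "c * B < \<beta> k"
    using B assms(4) unfolding c_def by (auto simp: field_simps)
  note growth = skew_energy_growth[OF assms(2) \<beta>0 assms(3) c(2) c(3)[unfolded B_def]]
  have "\<not> strongly_stable s \<alpha>"
  proof
    assume "strongly_stable s \<alpha>"
    then obtain d where d: "0 < d" and stable: "\<And>N H L \<tau>. sym_pos_def N H \<Longrightarrow> semi_negative N H L \<Longrightarrow>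
        0 < \<tau> \<Longrightarrow> \<tau> * opnorm_H H L \<le> d \<Longrightarrow> opnorm_H H (rk_operator s \<alpha> \<tau> L) \<le> 1"
      unfolding strongly_stable_def by blast
    define H :: "real mat" where "H = 1\<^sub>m 2"
    \<comment> \<open>This is the generator of plane rotations. Dimension 2 is the smallest with a
      nonzero skew operator.\<close>
    define L :: "real mat" where "L = mat 2 2 (\<lambda>(i, j). real j - real i)"
    have S: "sym_pos_def 2 H" unfolding H_def by (rule sym_pos_def_one)
    have L: "L \<in> carrier_mat 2 2" unfolding L_def by simp
    have "transpose_mat L + L = 0\<^sub>m 2 2"
      unfolding L_def by (intro eq_matI) auto
    then have skew: "transpose_mat L * H + H * L = 0\<^sub>m 2 2"
      unfolding H_def using L by simp
    have neg: "semi_negative 2 H L"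
      unfolding semi_negative_def skew using L by simp
    have "(L *\<^sub>v unit_vec 2 1) $ 0 \<noteq> 0\<^sub>v 2 $ 0"
      unfolding L_def by simp
    then have "L *\<^sub>v unit_vec 2 1 \<noteq> 0\<^sub>v 2" by metis
    then have pos: "0 < opnorm_H H L"
      using opnorm_H_pos_iff[OF S L] by fastforce
    \<comment> \<open>The scaled norm becomes exactly \<open>min c d\<close>, within both the growth
      threshold and the supposed stability threshold.\<close>
    define \<tau> where "\<tau> = min c d / opnorm_H H L"
    have \<tau>: "0 < \<tau>" "\<tau> * opnorm_H H L = min c d"
      unfolding \<tau>_def using pos c(1) d by auto
    have "1 < opnorm_H H (rk_operator s \<alpha> \<tau> L)"
      using growth[OF S L skew \<tau>(1)] \<tau>(2) c(1) d by simp
    moreover have "opnorm_H H (rk_operator s \<alpha> \<tau> L) \<le> 1"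
      using stable[OF S neg \<tau>(1)] \<tau>(2) by simp
    ultimately show False by simp
  qed
  then show ?thesis using c(1) growth by blast
qed

end
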